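(* Let $\mathbb{D}$ be a division algebra over $\mathbb{R}$, that is, $\mathbb{R}$, $\mathbb{C}$ or $\mathbb{H}$, let $d=\dim_{\mathbb{R}}\mathbb{D}$, let $n$ be an integer and let $\mu\in\mathbb{C}\setminus 0$. Put $$B_R=\mathrm{Mat}_n(\mathbb{D}),\qquad l_{B_R}(x)=\mu\,\mathrm{Re}\,\mathrm{Tr}(x)\ \text{ for } x\in\mathrm{Mat}_n(\mathbb{D}),$$ $$A_R=Z(\mathbb{D}),\qquad l_{A_R}(a)=\mu^2\,\mathrm{Re}(a)/d\ \text{ for } a\in Z(\mathbb{D}),\qquad \phi_R(a)=a\,\mathrm{Id}\in Z(B_R),$$ $$a^{\star_R}=\overline{a}\ (a\in A_R),\qquad x^{\star_R}=\overline{x}^{\,t}\ (x\in B_R),\qquad U_R=\frac{2-d}{\mu}\in A_R,$$ where the bar is the standard conjugation of $\mathbb{D}$ (applied entrywise to matrices) and ${}^t$ is matrix transposition. Then $H^{\mathbb{D}}_{n,\mu}=((A_R,l_{A_R}),(B_R,l_{B_R}),\phi_R,U_R,\star_R)$ is a semi-simple real equipped Cardy--Frobenius algebra.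
   Context: All algebras are finite-dimensional, associative and unital over a field $\mathbb{K}$. $Z(\cdot)$ denotes the center, $\mathrm{Re}$ denotes the real part in $\mathbb{D}$, and $\mathrm{Tr}(x)\in\mathbb{D}$ is the sum of the diagonal entries of $x$. A Frobenius pair $(C,l_C)$ is an algebra $C$ with a linear functional $l_C$ such that the bilinear form $(c_1,c_2)_C=l_C(c_1c_2)$ is symmetric and non-degenerate. A Cardy--Frobenius algebra $((A,l_A),(B,l_B),\phi)$ consists of: (1) a commutative Frobenius pair $(A,l_A)$; (2) an arbitrary Frobenius pair $(B,l_B)$, not necessarily commutative; (3) an algebra homomorphism $\phi:A\to B$ whose image is contained in the center of $B$ and which satisfies the Cardy condition $(\phi^*(b'),\phi^*(b''))_A=\mathrm{Tr}\,W^B_{b'b''}$ for all $b',b''\in B$. Here $\phi^*:B\to A$ is the dual map, defined by $(\phi^*(b),a)_A=(b,\phi(a))_B$, and $W^B_{b'b''}:B\to B$ is the linear operator $b\mapsto b'bb''$ (its trace is taken over $\mathbb{K}$). An equipped Cardy--Frobenius algebra $((A,l_A),(B,l_B),\phi,U,\star)$ is a Cardy--Frobenius algebra together with: involutive linear anti-automorphisms $\star:A\to A$ and $\star:B\to B$ such that $l_A(x^\star)=l_A(x)$, $l_B(x^\star)=l_B(x)$, $\phi(x^\star)=\phi(x)^\star$; and an element $U\in A$ such that $U^2=K_A^\star$ and $\phi(U)=K_B^\star$. Here, for a Frobenius pair $(C,l_C)$ with basis $\gamma_1,\dots,\gamma_N$ and with $(F_C^{ij})$ the inverse of the matrix $((\gamma_i,\gamma_j)_C)$,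 one puts $K_C^\star=\sum_{i,j}F_C^{ij}\gamma_i\gamma_j^\star$. Such a structure is semi-simple if the algebras $A$ and $B$ are semi-simple; it is real if $A$ and $B$ are algebras over $\mathbb{K}=\mathbb{R}$.
   Formalization: The parameter μ is taken in ℝ∖0 instead of ℂ∖0: for non-real μ the functional l_B takes the non-real value μn at Id, so it is not a linear functional over ℝ and the claimed real structure is not defined. *)

theory Defs
  imports "HOL-Analysis.Analysis"
begin

text \<open>
  An algebra is carried by a subspace of an ambient vector space, which supplies addition, zero
  and scalar multiplication. Product and functional are unconstrained outside the carrier.
\<close>

record ('k, 'a) algebra_data =
  carrier :: "'a set"
  smult :: "'k \<Rightarrow> 'a \<Rightarrow> 'a"
  mult :: "'a \<Rightarrow> 'a \<Rightarrow> 'a"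
  unity :: "'a"

record ('k, 'a) frobenius_data = "('k, 'a) algebra_data" +
  functional :: "'a \<Rightarrow> 'k"

locale fd_algebra = vector_space "smult C"
  for C :: "('k::field, 'a::ab_group_add, 'm) algebra_data_scheme" +
  assumes fin_dim: "\<exists>S. finite S \<and> span S = carrier C"
    and mult_closed: "\<lbrakk>x \<in> carrier C; y \<in> carrier C\<rbrakk> \<Longrightarrow> mult C x y \<in> carrier C"
    and unity_closed: "unity C \<in> carrier C"
    and mult_assoc: "\<lbrakk>x \<in> carrier C; y \<in> carrier C; z \<in> carrier C\<rbrakk>
          \<Longrightarrow> mult C (mult C x y) z = mult C x (mult C y z)"
    and unity_left: "x \<in> carrier C \<Longrightarrow> mult C (unity C) x = x"
    and unity_right: "x \<in> carrier C \<Longrightarrow> mult C x (unity C) = x"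
    and distrib_left: "\<lbrakk>x \<in> carrier C; y \<in> carrier C; z \<in> carrier C\<rbrakk>
          \<Longrightarrow> mult C x (y + z) = mult C x y + mult C x z"
    and distrib_right: "\<lbrakk>x \<in> carrier C; y \<in> carrier C; z \<in> carrier C\<rbrakk>
          \<Longrightarrow> mult C (x + y) z = mult C x z + mult C y z"
    and smult_mult_left: "\<lbrakk>x \<in> carrier C; y \<in> carrier C\<rbrakk>
          \<Longrightarrow> mult C (smult C r x) y = smult C r (mult C x y)"
    and smult_mult_right: "\<lbrakk>x \<in> carrier C; y \<in> carrier C\<rbrakk>
          \<Longrightarrow> mult C x (smult C r y) = smult C r (mult C x y)"
begin

definition center :: "'a set" where
  "center = {z \<in> carrier C. \<forall>x\<in>carrier C. mult C z x = mult C x z}"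

definition is_basis :: "'a set \<Rightarrow> bool" where
  "is_basis G \<longleftrightarrow> finite G \<and> independent G \<and> span G = carrier C"

text \<open>The trace of a linear operator on the carrier; it does not depend on the basis chosen.\<close>

definition operator_trace :: "('a \<Rightarrow> 'a) \<Rightarrow> 'k" where
  "operator_trace f =
     (let G = SOME G. is_basis G in \<Sum>g\<in>G. representation G (f g) g)"

definition left_ideal :: "'a set \<Rightarrow> bool" where
  "left_ideal I \<longleftrightarrow> subspace I \<and> I \<subseteq> carrier C \<and>
     (\<forall>c\<in>carrier C. \<forall>x\<in>I. mult C c x \<in> I)"

text \<open>Semisimplicity of the left regular module: every submodule is a direct summand.\<close>

definition semisimple :: bool where
  "semisimple \<longleftrightarrow> (\<forall>I. left_ideal I \<longrightarrow>
     (\<exists>J. left_ideal J \<and> I \<inter> J = {0} \<and> {x + y |x y. x \<in> I \<and> y \<in> J} = carrier C))"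

definition linear_involutive_antiautomorphism :: "('a \<Rightarrow> 'a) \<Rightarrow> bool" where
  "linear_involutive_antiautomorphism s \<longleftrightarrow>
     (\<forall>x\<in>carrier C. s x \<in> carrier C \<and> s (s x) = x) \<and>
     (\<forall>x\<in>carrier C. \<forall>y\<in>carrier C. s (x + y) = s x + s y) \<and>
     (\<forall>r. \<forall>x\<in>carrier C. s (smult C r x) = smult C r (s x)) \<and>
     (\<forall>x\<in>carrier C. \<forall>y\<in>carrier C. s (mult C x y) = mult C (s y) (s x))"

end

definition pairing :: "('k, 'a, 'm) frobenius_data_scheme \<Rightarrow> 'a \<Rightarrow> 'a \<Rightarrow> 'k" where
  "pairing C x y = functional C (mult C x y)"

locale frobenius_pair = fd_algebra C
  for C :: "('k::field, 'a::ab_group_add, 'm) frobenius_data_scheme" +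
  assumes functional_add: "\<lbrakk>x \<in> carrier C; y \<in> carrier C\<rbrakk>
          \<Longrightarrow> functional C (x + y) = functional C x + functional C y"
    and functional_smult: "x \<in> carrier C
          \<Longrightarrow> functional C (smult C r x) = r * functional C x"
    and pairing_sym: "\<lbrakk>x \<in> carrier C; y \<in> carrier C\<rbrakk> \<Longrightarrow> pairing C x y = pairing C y x"
    and pairing_nondegenerate: "\<lbrakk>x \<in> carrier C; \<And>y. y \<in> carrier C \<Longrightarrow> pairing C x y = 0\<rbrakk>
          \<Longrightarrow> x = 0"
begin

text \<open>
  \<open>F\<close> is the inverse of the Gram matrix of the basis \<open>G\<close>, with rows and columns indexed by the
  basis vectors themselves; it is determined on \<open>G \<times> G\<close>, the only place where it is used. The
  resulting element does not depend on the basis chosen.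
\<close>

definition gram_inverse :: "'a set \<Rightarrow> ('a \<Rightarrow> 'a \<Rightarrow> 'k) \<Rightarrow> bool" where
  "gram_inverse G F \<longleftrightarrow> (\<forall>x\<in>G. \<forall>y\<in>G.
     (\<Sum>z\<in>G. F x z * pairing C z y) = (if x = y then 1 else 0))"

definition K_star :: "('a \<Rightarrow> 'a) \<Rightarrow> 'a" where
  "K_star s =
     (let G = SOME G. is_basis G; F = SOME F. gram_inverse G F
      in \<Sum>x\<in>G. \<Sum>y\<in>G. smult C (F x y) (mult C x (s y)))"

end

definition dual_map ::
  "('k, 'a, 'm) frobenius_data_scheme \<Rightarrow> ('k, 'b, 'l) frobenius_data_scheme
     \<Rightarrow> ('a \<Rightarrow> 'b) \<Rightarrow> 'b \<Rightarrow> 'a" where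
  "dual_map A B \<phi> b =
     (THE x. x \<in> carrier A \<and> (\<forall>a\<in>carrier A. pairing A x a = pairing B b (\<phi> a)))"

locale cardy_frobenius_algebra = A: frobenius_pair A + B: frobenius_pair B
  for A :: "('k::field, 'a::ab_group_add) frobenius_data"
    and B :: "('k, 'b::ab_group_add) frobenius_data" +
  fixes \<phi> :: "'a \<Rightarrow> 'b"
  assumes A_commutative: "\<lbrakk>x \<in> carrier A; y \<in> carrier A\<rbrakk> \<Longrightarrow> mult A x y = mult A y x"
    and phi_add: "\<lbrakk>x \<in> carrier A; y \<in> carrier A\<rbrakk> \<Longrightarrow> \<phi> (x + y) = \<phi> x + \<phi> y"
    and phi_smult: "x \<in> carrier A \<Longrightarrow> \<phi> (smult A r x) = smult B r (\<phi> x)"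
    and phi_mult: "\<lbrakk>x \<in> carrier A; y \<in> carrier A\<rbrakk> \<Longrightarrow> \<phi> (mult A x y) = mult B (\<phi> x) (\<phi> y)"
    and phi_unity: "\<phi> (unity A) = unity B"
    and phi_center: "\<phi> ` carrier A \<subseteq> B.center"
    and cardy: "\<lbrakk>b' \<in> carrier B; b'' \<in> carrier B\<rbrakk>
          \<Longrightarrow> pairing A (dual_map A B \<phi> b') (dual_map A B \<phi> b'')
            = B.operator_trace (\<lambda>b. mult B (mult B b' b) b'')"

locale equipped_cardy_frobenius_algebra = cardy_frobenius_algebra A B \<phi>
  for A :: "('k::field, 'a::ab_group_add) frobenius_data"
    and B :: "('k, 'b::ab_group_add) frobenius_data"
    and \<phi> :: "'a \<Rightarrow> 'b" +
  fixes U :: 'a and starA :: "'a \<Rightarrow> 'a" and starB :: "'b \<Rightarrow> 'b"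
  assumes starA: "A.linear_involutive_antiautomorphism starA"
    and starB: "B.linear_involutive_antiautomorphism starB"
    and functional_starA: "x \<in> carrier A \<Longrightarrow> functional A (starA x) = functional A x"
    and functional_starB: "y \<in> carrier B \<Longrightarrow> functional B (starB y) = functional B y"
    and phi_star: "x \<in> carrier A \<Longrightarrow> \<phi> (starA x) = starB (\<phi> x)"
    and U_closed: "U \<in> carrier A"
    and U_square: "mult A U U = A.K_star starA"
    and phi_U: "\<phi> U = B.K_star starB"

type_synonym ('k, 'a, 'b) equipped_data =
  "('k, 'a) frobenius_data \<times> ('k, 'b) frobenius_data \<times> ('a \<Rightarrow> 'b) \<times> 'a \<times> ('a \<Rightarrow> 'a) \<times> ('b \<Rightarrow> 'b)"

definition semisimple_equipped_cardy_frobenius_algebra ::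
  "('k::field, 'a::ab_group_add, 'b::ab_group_add) equipped_data \<Rightarrow> bool" where
  "semisimple_equipped_cardy_frobenius_algebra = (\<lambda>(A, B, \<phi>, U, starA, starB).
     equipped_cardy_frobenius_algebra A B \<phi> U starA starB \<and>
     fd_algebra.semisimple A \<and> fd_algebra.semisimple B)"

abbreviation semisimple_real_equipped_cardy_frobenius_algebra ::
  "(real, 'a::ab_group_add, 'b::ab_group_add) equipped_data \<Rightarrow> bool" where
  "semisimple_real_equipped_cardy_frobenius_algebra \<equiv> semisimple_equipped_cardy_frobenius_algebra"

datatype quat = Quat (qRe: real) (qI: real) (qJ: real) (qK: real)

lemma quat_eq_iff: "p = q \<longleftrightarrow> qRe p = qRe q \<and> qI p = qI q \<and> qJ p = qJ q \<and> qK p = qK q"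
  by (cases p; cases q) simp

instantiation quat :: real_algebra_1
begin

definition "0 = Quat 0 0 0 0"
definition "1 = Quat 1 0 0 0"
definition "p + q = Quat (qRe p + qRe q) (qI p + qI q) (qJ p + qJ q) (qK p + qK q)"
definition "p - q = Quat (qRe p - qRe q) (qI p - qI q) (qJ p - qJ q) (qK p - qK q)"
definition "- p = Quat (- qRe p) (- qI p) (- qJ p) (- qK p)"
definition "r *\<^sub>R p = Quat (r * qRe p) (r * qI p) (r * qJ p) (r * qK p)"
definition "p * q = Quat
  (qRe p * qRe q - qI p * qI q - qJ p * qJ q - qK p * qK q)
  (qRe p * qI q + qI p * qRe q + qJ p * qK q - qK p * qJ q)
  (qRe p * qJ q - qI p * qK q + qJ p * qRe q + qK p * qI q)
  (qRe p * qK q + qI p * qJ q - qJ p * qI q + qK p * qRe q)"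

lemmas quat_defs = zero_quat_def one_quat_def plus_quat_def minus_quat_def uminus_quat_def
  scaleR_quat_def times_quat_def

instance
  by intro_classes (simp_all add: quat_eq_iff quat_defs algebra_simps)

end

definition qcnj :: "quat \<Rightarrow> quat" where
  "qcnj q = Quat (qRe q) (- qI q) (- qJ q) (- qK q)"

instantiation quat :: real_div_algebra
begin

definition "inverse q = ((1 / ((qRe q)\<^sup>2 + (qI q)\<^sup>2 + (qJ q)\<^sup>2 + (qK q)\<^sup>2)) *\<^sub>R qcnj q :: quat)"
definition "p div q = (p * inverse q :: quat)"

instance
proof
  fix q :: quat
  assume q: "q \<noteq> 0"
  define N where "N = (qRe q)\<^sup>2 + (qI q)\<^sup>2 + (qJ q)\<^sup>2 + (qK q)\<^sup>2"
  have "N \<noteq> 0"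
    using q unfolding N_def
    by (auto simp: quat_eq_iff zero_quat_def add_nonneg_eq_0_iff)
  moreover have "qcnj q * q = N *\<^sub>R 1" "q * qcnj q = N *\<^sub>R 1"
    by (simp_all add: quat_eq_iff quat_defs qcnj_def N_def power2_eq_square)
  ultimately show "inverse q * q = 1" "q * inverse q = 1"
    by (simp_all add: inverse_quat_def flip: N_def)
next
  show "inverse (0 :: quat) = 0"
    by (simp add: inverse_quat_def quat_eq_iff quat_defs qcnj_def)
qed (simp add: divide_quat_def)

end

text \<open>
  Below, \<open>'d\<close> is the division algebra, \<open>re\<close> and \<open>cj\<close> are its real part and its standard
  conjugation, and the matrix size is \<open>CARD('n)\<close>. The parameter \<open>\<mu>\<close> has to be real: otherwise
  the functionals are not real-valued, and \<open>U_H \<mu>\<close> does not lie in the algebra when its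
  dimension is 1 or 4. The product on \<open>'d^'n^'n\<close> is
  the matrix product, not the componentwise product of the type class.
\<close>

definition A_H :: "('d::real_div_algebra \<Rightarrow> real) \<Rightarrow> real \<Rightarrow> (real, 'd) frobenius_data" where
  "A_H re \<mu> =
     \<lparr>carrier = {z. \<forall>x. z * x = x * z},
      smult = (*\<^sub>R), mult = (*), unity = 1,
      functional = (\<lambda>a. \<mu>\<^sup>2 * re a / real (dim (UNIV :: 'd set)))\<rparr>"

definition B_H :: "('d::real_div_algebra \<Rightarrow> real) \<Rightarrow> real \<Rightarrow> (real, 'd^'n^'n) frobenius_data" where
  "B_H re \<mu> =
     \<lparr>carrier = UNIV,
      smult = (*\<^sub>R), mult = (**), unity = mat 1,
      functional = (\<lambda>x. \<mu> * re (trace x))\<rparr>"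

definition U_H :: "real \<Rightarrow> 'd::real_div_algebra" where
  "U_H \<mu> = of_real ((2 - real (dim (UNIV :: 'd set))) / \<mu>)"

definition conj_transpose :: "('d \<Rightarrow> 'd) \<Rightarrow> 'd^'n^'n \<Rightarrow> 'd^'n^'n" where
  "conj_transpose cj x = transpose (map_matrix cj x)"

text \<open>Here \<open>mat a\<close> is the scalar matrix with \<open>a\<close> on the diagonal.\<close>

definition H_alg :: "('d::real_div_algebra \<Rightarrow> real) \<Rightarrow> ('d \<Rightarrow> 'd) \<Rightarrow> real
    \<Rightarrow> (real, 'd, 'd^'n^'n) equipped_data" where
  "H_alg re cj \<mu> = (A_H re \<mu>, B_H re \<mu>, mat, U_H \<mu>, cj, conj_transpose cj)"

end

theory Submission
  imports Defs
begin

text \<open>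
  The three division algebras are treated at once. Let \<open>E\<close> be the basis \<open>{1}\<close>, \<open>{1, i}\<close> or
  \<open>{1, i, j, k}\<close>, which is orthonormal for the inner product \<open>re (x * cj y)\<close>. Everything rests on
  the Casimir operator \<open>T q = (\<Sum>e\<in>E. e * q * cj e)\<close>. Its values are central, it multiplies central
  elements by \<open>d = card E\<close>, and \<open>re (T q * z) = d * re (q * z)\<close> for central \<open>z\<close>; thus \<open>T / d\<close> is the
  orthogonal projection onto the centre. Since \<open>cj x = 2 * re x - x\<close>, it also has the closed form
  \<open>T q = 2 * q + (d - 2) * cj q\<close>.

  Traces and the elements \<open>K\<^sup>\<star>\<close> are defined through an arbitrary basis. Both can be computed from any
  pair of finite families \<open>b\<close>, \<open>b'\<close> such that \<open>x\<close> is the sum of the \<open>(x, b' i) b i\<close> for every \<open>x\<close>;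
  such families need not be linearly independent. For the matrix algebra the matrices with a single
  nonzero entry from \<open>E\<close> provide such a family, for the centre the projections of \<open>E\<close> do, although
  these are linearly dependent over the quaternions.

  The dual map is \<open>b \<mapsto> T (trace b) / \<mu>\<close>, and both sides of the Cardy condition are equal to
  \<open>re (trace b' * T (trace b''))\<close>: for the trace of \<open>b \<mapsto> b' ** b ** b''\<close> this is the definition of
  \<open>T\<close>, for the pairing it is the projection property. The condition on \<open>\<phi> U\<close> reduces to
  \<open>(\<Sum>e\<in>E. e * e) = 2 - d\<close>, and the one on the square of \<open>U\<close> to
  \<open>(\<Sum>e\<in>E. T e * T e) = d * (2 - d)\<^sup>2\<close>. By the closed form of \<open>T\<close>, the latter is an equation for \<open>d\<close>
  alone, whose solutions are exactly 1, 2 and 4.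

  Both algebras are semisimple because the form \<open>(x, x\<^sup>\<star>)\<close> is anisotropic, so that the orthogonal
  complement of a left ideal is a complementary left ideal.
\<close>

section \<open>Dual families in Frobenius pairs\<close>

context fd_algebra
begin

definition linear_endo :: "('a \<Rightarrow> 'a) \<Rightarrow> bool" where
  "linear_endo f \<longleftrightarrow> (\<forall>x\<in>carrier C. f x \<in> carrier C) \<and>
     (\<forall>x\<in>carrier C. \<forall>y\<in>carrier C. f (x + y) = f x + f y) \<and>
     (\<forall>r. \<forall>x\<in>carrier C. f (smult C r x) = smult C r (f x))"

lemma subspace_carrier: "subspace (carrier C)"
  using fin_dim subspace_span by metis

lemma zero_closed: "0 \<in> carrier C"
  and add_closed: "x \<in> carrier C \<Longrightarrow> y \<in> carrier C \<Longrightarrow> x + y \<in> carrier C"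
  and smult_closed: "x \<in> carrier C \<Longrightarrow> smult C r x \<in> carrier C"
  and sum_closed: "(\<And>i. i \<in> I \<Longrightarrow> h i \<in> carrier C) \<Longrightarrow> sum h I \<in> carrier C"
  using subspace_carrier
  by (auto intro: subspace_0 subspace_add subspace_scale subspace_sum)

lemma diff_closed: "x \<in> carrier C \<Longrightarrow> y \<in> carrier C \<Longrightarrow> x - y \<in> carrier C"
  using subspace_carrier by (rule subspace_diff)

lemma ex_is_basis: "\<exists>G. is_basis G"
proof -
  obtain S where S: "finite S" "span S = carrier C"
    using fin_dim by blast
  obtain G where G: "G \<subseteq> S" "independent G" "S \<subseteq> span G"
    using maximal_independent_subset[of S] by blast
  have "span G = carrier C"
    using G(1,3) S(2) by (metis span_mono span_span subset_antisym)
  then show ?thesis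
    using G(1,2) S(1) finite_subset unfolding is_basis_def by blast
qed

lemma is_basisD:
  assumes "is_basis G"
  shows "finite G" "independent G" "span G = carrier C" "G \<subseteq> carrier C"
  using assms span_superset unfolding is_basis_def by auto

lemma basis_expansion:
  assumes "is_basis G" "x \<in> carrier C"
  shows "(\<Sum>g\<in>G. smult C (representation G x g) g) = x"
  using is_basisD[OF assms(1)] assms(2) by (intro sum_representation_eq) auto

lemma representation_lincomb:
  assumes "is_basis G" "\<And>i. i \<in> I \<Longrightarrow> b i \<in> carrier C"
  shows "representation G (\<Sum>i\<in>I. smult C (r i) (b i)) g = (\<Sum>i\<in>I. r i * representation G (b i) g)"
  using is_basisD[OF assms(1)] assms(2)
  by (simp add: representation_sum representation_scale smult_closed)

lemma linear_endo_closed: "linear_endo f \<Longrightarrow> x \<in> carrier C \<Longrightarrow> f x \<in> carrier C"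
  unfolding linear_endo_def by blast

lemma linear_endo_lincomb:
  assumes f: "linear_endo f" and b: "\<And>i. i \<in> I \<Longrightarrow> b i \<in> carrier C"
  shows "f (\<Sum>i\<in>I. smult C (r i) (b i)) = (\<Sum>i\<in>I. smult C (r i) (f (b i)))"
proof -
  have "f (0 + 0) = f 0 + f 0"
    using f zero_closed unfolding linear_endo_def by blast
  then have f0: "f 0 = 0" by simp
  show ?thesis using b
  proof (induction I rule: infinite_finite_induct)
    case (insert i I)
    then show ?case
      using f unfolding linear_endo_def by (simp add: smult_closed sum_closed)
  qed (simp_all add: f0)
qed

lemma linear_endo_mult_left: "a \<in> carrier C \<Longrightarrow> linear_endo (mult C a)"
  unfolding linear_endo_def by (simp add: mult_closed distrib_left smult_mult_right)

lemma linear_endo_mult_right: "a \<in> carrier C \<Longrightarrow> linear_endo (\<lambda>x. mult C x a)"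
  unfolding linear_endo_def by (simp add: mult_closed distrib_right smult_mult_left)

lemma linear_endo_comp: "linear_endo f \<Longrightarrow> linear_endo g \<Longrightarrow> linear_endo (\<lambda>x. f (g x))"
  unfolding linear_endo_def by simp

lemma linear_endo_antiautomorphism:
  "linear_involutive_antiautomorphism s \<Longrightarrow> linear_endo s"
  unfolding linear_involutive_antiautomorphism_def linear_endo_def by simp

end

context frobenius_pair
begin

text \<open>
  The families play the role of a basis and its dual basis for the pairing, but may be linearly
  dependent.
\<close>

definition dual_families :: "'i set \<Rightarrow> ('i \<Rightarrow> 'a) \<Rightarrow> ('i \<Rightarrow> 'a) \<Rightarrow> bool" where
  "dual_families I b b' \<longleftrightarrow> finite I \<and> b ` I \<subseteq> carrier C \<and> b' ` I \<subseteq> carrier C \<and>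
     (\<forall>x\<in>carrier C. (\<Sum>i\<in>I. smult C (pairing C x (b' i)) (b i)) = x)"

lemma pairing_add_left:
  "\<lbrakk>x \<in> carrier C; y \<in> carrier C; z \<in> carrier C\<rbrakk>
     \<Longrightarrow> pairing C (x + y) z = pairing C x z + pairing C y z"
  unfolding pairing_def by (simp add: distrib_right functional_add mult_closed)

lemma pairing_smult_left:
  "\<lbrakk>x \<in> carrier C; z \<in> carrier C\<rbrakk> \<Longrightarrow> pairing C (smult C r x) z = r * pairing C x z"
  unfolding pairing_def by (simp add: smult_mult_left functional_smult mult_closed)

lemma pairing_zero_left: "z \<in> carrier C \<Longrightarrow> pairing C 0 z = 0"
  using pairing_smult_left[of 0 z 0] zero_closed by simp

lemma pairing_lincomb_left:
  assumes "\<And>i. i \<in> I \<Longrightarrow> b i \<in> carrier C" "z \<in> carrier C"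
  shows "pairing C (\<Sum>i\<in>I. smult C (r i) (b i)) z = (\<Sum>i\<in>I. r i * pairing C (b i) z)"
  using assms
  by (induction I rule: infinite_finite_induct)
    (simp_all add: pairing_zero_left pairing_add_left pairing_smult_left smult_closed sum_closed)

text \<open>
  Expanding \<open>f g\<close> in the first family and collecting the coordinates of each \<open>b i\<close> replaces the sum
  over the chosen basis by a sum over the family.
\<close>

lemma operator_trace_dual_families:
  assumes D: "dual_families I b b'" and f: "linear_endo f"
  shows "operator_trace f = (\<Sum>i\<in>I. pairing C (f (b i)) (b' i))"
proof -
  define G where "G = (SOME G. is_basis G)"
  have G: "is_basis G"
    unfolding G_def using ex_is_basis by (rule someI_ex)
  note G' = is_basisD[OF G]
  have b: "b i \<in> carrier C" "b' i \<in> carrier C" if "i \<in> I" for i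
    using D that unfolding dual_families_def by auto
  have fg: "f g \<in> carrier C" if "g \<in> G" for g
    using linear_endo_closed[OF f] G'(4) that by blast
  have "operator_trace f = (\<Sum>g\<in>G. representation G (f g) g)"
    unfolding operator_trace_def Let_def G_def ..
  also have "\<dots> = (\<Sum>g\<in>G. representation G (\<Sum>i\<in>I. smult C (pairing C (f g) (b' i)) (b i)) g)"
    using D fg unfolding dual_families_def by (intro sum.cong) auto
  also have "\<dots> = (\<Sum>g\<in>G. \<Sum>i\<in>I. pairing C (f g) (b' i) * representation G (b i) g)"
    using b by (simp add: representation_lincomb[OF G])
  also have "\<dots> = (\<Sum>i\<in>I. \<Sum>g\<in>G. representation G (b i) g * pairing C (f g) (b' i))"
    by (subst sum.swap) (simp add: mult.commute)
  also have "\<dots> = (\<Sum>i\<in>I. pairing C (\<Sum>g\<in>G. smult C (representation G (b i) g) (f g)) (b' i))"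
    using b fg by (simp add: pairing_lincomb_left)
  also have "\<dots> = (\<Sum>i\<in>I. pairing C (f (\<Sum>g\<in>G. smult C (representation G (b i) g) g)) (b' i))"
    using G'(4) by (simp add: linear_endo_lincomb[OF f] subset_eq)
  also have "\<dots> = (\<Sum>i\<in>I. pairing C (f (b i)) (b' i))"
    using b by (simp add: basis_expansion[OF G])
  finally show ?thesis .
qed

text \<open>
  For the chosen basis \<open>G\<close> with inverse Gram matrix \<open>F\<close>, the vectors \<open>(\<Sum>y\<in>G. F x y y)\<close> form the dual
  basis. Its members are combinations of the \<open>b' i\<close>, with the coordinates of the \<open>b i\<close> as
  coefficients, and substituting this into the double sum gives the result.
\<close>

lemma K_star_dual_families:
  assumes D: "dual_families I b b'" and s: "linear_endo s"
  shows "K_star s = (\<Sum>i\<in>I. mult C (b i) (s (b' i)))"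
proof -
  define G where "G = (SOME G. is_basis G)"
  have G: "is_basis G"
    unfolding G_def using ex_is_basis by (rule someI_ex)
  note G' = is_basisD[OF G]
  have gc: "g \<in> carrier C" if "g \<in> G" for g
    using G'(4) that by blast
  have b: "b i \<in> carrier C" "b' i \<in> carrier C" if "i \<in> I" for i
    using D that unfolding dual_families_def by auto
  \<comment> \<open>the dual basis of \<open>G\<close>\<close>
  define d where "d g = (\<Sum>i\<in>I. smult C (representation G (b i) g) (b' i))" for g
  have dc: "d g \<in> carrier C" for g
    unfolding d_def using b by (intro sum_closed smult_closed)
  have d_pair: "pairing C (d g) h = (if g = h then 1 else 0)" if h: "h \<in> G" for g h
  proof -
    have "pairing C (d g) h = (\<Sum>i\<in>I. pairing C h (b' i) * representation G (b i) g)"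
      unfolding d_def using b gc[OF h]
      by (simp add: pairing_lincomb_left pairing_sym[of h] mult.commute)
    also have "\<dots> = representation G (\<Sum>i\<in>I. smult C (pairing C h (b' i)) (b i)) g"
      using b by (simp add: representation_lincomb[OF G])
    also have "\<dots> = representation G h g"
      using D gc[OF h] unfolding dual_families_def by simp
    also have "\<dots> = (if g = h then 1 else 0)"
      using representation_basis[OF G'(2) h] by auto
    finally show ?thesis .
  qed
  \<comment> \<open>\<open>SOME\<close> only yields an inverse Gram matrix once one is known to exist; the coordinates of the
    dual basis are one\<close>
  define F where "F = (SOME F. gram_inverse G F)"
  have "gram_inverse G (\<lambda>g h. representation G (d g) h)"
    unfolding gram_inverse_def
  proof (intro ballI)
    fix x y assume "x \<in> G" "y \<in> G"
    then show "(\<Sum>z\<in>G. representation G (d x) z * pairing C z y) = (if x = y then 1 else 0)"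
      using gc pairing_lincomb_left[of G "\<lambda>z. z" y "representation G (d x)"]
      by (simp add: basis_expansion[OF G dc] d_pair)
  qed
  then have F: "gram_inverse G F"
    unfolding F_def by (rule someI[of "gram_inverse G"])
  have F_row: "(\<Sum>y\<in>G. smult C (F x y) y) = d x" if x: "x \<in> G" for x
  proof -
    let ?f = "\<Sum>y\<in>G. smult C (F x y) y"
    have fc: "?f \<in> carrier C"
      using gc by (intro sum_closed smult_closed)
    have eqG: "pairing C ?f h = pairing C (d x) h" if h: "h \<in> G" for h
      using F x h gc unfolding gram_inverse_def by (simp add: pairing_lincomb_left d_pair)
    have "pairing C (?f - d x) y = 0" if y: "y \<in> carrier C" for y
    proof -
      have "pairing C z y = (\<Sum>g\<in>G. representation G y g * pairing C z g)"
        if z: "z \<in> carrier C" for z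
        using pairing_lincomb_left[of G "\<lambda>g. g" z "representation G y"] gc z y
        by (simp add: basis_expansion[OF G y] pairing_sym[of z])
      then have "pairing C ?f y = pairing C (d x) y"
        using fc dc eqG by simp
      moreover have "pairing C (?f - d x) y + pairing C (d x) y = pairing C ?f y"
        using pairing_add_left[of "?f - d x" "d x" y] fc dc y diff_closed by simp
      ultimately show ?thesis by simp
    qed
    then show ?thesis
      using pairing_nondegenerate[of "?f - d x"] fc dc diff_closed by simp
  qed
  have sc: "s x \<in> carrier C" if "x \<in> carrier C" for x
    using linear_endo_closed[OF s] that .
  have ms: "linear_endo (\<lambda>y. mult C x (s y))" if "x \<in> carrier C" for x
    using linear_endo_comp[OF linear_endo_mult_left[OF that] s] .
  have "K_star s = (\<Sum>x\<in>G. \<Sum>y\<in>G. smult C (F x y) (mult C x (s y)))"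
    unfolding K_star_def Let_def G_def F_def ..
  also have "\<dots> = (\<Sum>x\<in>G. mult C x (s (\<Sum>y\<in>G. smult C (F x y) y)))"
    using gc by (intro sum.cong refl linear_endo_lincomb[OF ms, symmetric]) auto
  also have "\<dots> = (\<Sum>x\<in>G. mult C x (s (\<Sum>i\<in>I. smult C (representation G (b i) x) (b' i))))"
    by (simp add: F_row d_def)
  also have "\<dots> = (\<Sum>x\<in>G. \<Sum>i\<in>I. smult C (representation G (b i) x) (mult C x (s (b' i))))"
    using b gc by (intro sum.cong refl linear_endo_lincomb[OF ms]) auto
  also have "\<dots> = (\<Sum>i\<in>I. \<Sum>x\<in>G. smult C (representation G (b i) x) (mult C x (s (b' i))))"
    by (rule sum.swap)
  also have "\<dots> = (\<Sum>i\<in>I. mult C (\<Sum>x\<in>G. smult C (representation G (b i) x) x) (s (b' i)))"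
    using b gc sc
    by (intro sum.cong refl linear_endo_lincomb[OF linear_endo_mult_right, symmetric]) auto
  also have "\<dots> = (\<Sum>i\<in>I. mult C (b i) (s (b' i)))"
    using b by (simp add: basis_expansion[OF G])
  finally show ?thesis .
qed

section \<open>Semisimplicity from an anisotropic form\<close>

text \<open>
  The Gram--Schmidt step: a new generator is first made orthogonal to the span of the old ones, after
  which the projections onto the two parts add up. Anisotropy allows division by the value of the
  form at the new vector, unless that vector vanishes.
\<close>

lemma ex_orthogonal_projection:
  assumes lin: "linear_endo s"
    and sym: "\<And>x y. \<lbrakk>x \<in> carrier C; y \<in> carrier C\<rbrakk> \<Longrightarrow> pairing C x (s y) = pairing C y (s x)"
    and aniso: "\<And>x. \<lbrakk>x \<in> carrier C; pairing C x (s x) = 0\<rbrakk> \<Longrightarrow> x = 0"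
    and S: "finite S" "S \<subseteq> carrier C"
  shows "v \<in> carrier C \<Longrightarrow> \<exists>u\<in>span S. \<forall>x\<in>span S. pairing C x (s (v - u)) = 0"
  using S
proof (induction S arbitrary: v rule: finite_induct)
  case empty
  then show ?case
    using linear_endo_closed[OF lin] zero_closed by (simp add: pairing_zero_left)
next
  case (insert a S)
  have spc: "x \<in> carrier C" if "x \<in> span (insert a S)" for x
    using that span_minimal[OF insert.prems(2) subspace_carrier] by blast
  have spS: "x \<in> span (insert a S)" if "x \<in> span S" for x
    using that span_mono[of S "insert a S"] by blast
  have ac: "a \<in> carrier C" "S \<subseteq> carrier C"
    using insert.prems by auto
  have scl: "s x \<in> carrier C" if "x \<in> carrier C" for x
    using linear_endo_closed[OF lin that] .
  define \<beta> where "\<beta> x y = pairing C x (s y)" for x y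
  have \<beta>_add: "\<beta> (x + y) z = \<beta> x z + \<beta> y z" and \<beta>_smult: "\<beta> (smult C r x) z = r * \<beta> x z"
    and \<beta>_sym: "\<beta> x y = \<beta> y x"
    if "x \<in> carrier C" "y \<in> carrier C" "z \<in> carrier C" for x y z r
    using that sym unfolding \<beta>_def by (auto simp: pairing_add_left pairing_smult_left scl)
  have \<beta>_diff: "\<beta> (x - y) z = \<beta> x z - \<beta> y z"
    if "x \<in> carrier C" "y \<in> carrier C" "z \<in> carrier C" for x y z
    using \<beta>_add[of "x - y" y z] that diff_closed by simp
  obtain p where p: "p \<in> span S" "\<And>x. x \<in> span S \<Longrightarrow> \<beta> x (a - p) = 0"
    using insert.IH[OF ac(1) ac(2)] unfolding \<beta>_def by blast
  obtain w where w: "w \<in> span S" "\<And>x. x \<in> span S \<Longrightarrow> \<beta> x (v - w) = 0"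
    using insert.IH[OF insert.prems(1) ac(2)] unfolding \<beta>_def by blast
  \<comment> \<open>the component of the new generator orthogonal to the old ones\<close>
  define a' where "a' = a - p"
  have a'sp: "a' \<in> span (insert a S)"
    unfolding a'_def using spS[OF p(1)] by (intro span_diff) (auto intro: span_base)
  define r where "r = \<beta> v a' / \<beta> a' a'"
  define u where "u = w + smult C r a'"
  have usp: "u \<in> span (insert a S)"
    unfolding u_def by (intro span_add span_scale a'sp spS w)
  have closed: "v \<in> carrier C" "w \<in> carrier C" "a' \<in> carrier C" "u \<in> carrier C"
    using insert.prems spc[OF spS[OF w(1)]] spc[OF a'sp] spc[OF usp] by auto
  have ra: "r * \<beta> a' a' = \<beta> v a'"
  proof (cases "\<beta> a' a' = 0")
    case True
    then have "a' = 0" using aniso closed(3) unfolding \<beta>_def by blast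
    then show ?thesis
      using True \<beta>_sym[of v 0 0] closed zero_closed scl
      unfolding \<beta>_def by (simp add: pairing_zero_left)
  qed (simp add: r_def)
  have rest: "\<beta> x (v - u) = 0" if x: "x \<in> span (insert a S)" for x
  proof -
    obtain k where k: "x - smult C k a \<in> span S"
      using x by (auto simp: span_breakdown_eq)
    define y where "y = x - smult C k a + smult C k p"
    have y: "y \<in> span S"
      unfolding y_def by (intro span_add k span_scale p)
    have yc: "y \<in> carrier C" using spc[OF spS[OF y]] .
    have x_eq: "x = y + smult C k a'"
      unfolding y_def a'_def by (simp add: scale_right_diff_distrib)
    have vuc: "v - u \<in> carrier C" "v - w \<in> carrier C"
      using closed diff_closed by auto
    have vu: "v - u = (v - w) - smult C r a'"
      unfolding u_def by simp
    have exp: "\<beta> (v - u) z = \<beta> (v - w) z - r * \<beta> a' z" if "z \<in> carrier C" for z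
      unfolding vu using that vuc closed by (simp add: \<beta>_diff \<beta>_smult[of _ 0] smult_closed zero_closed)
    have "\<beta> y (v - u) = 0"
      using exp[OF yc] w(2)[OF y] p(2)[OF y, folded a'_def] yc closed vuc zero_closed
        \<beta>_sym[of y "v - u" 0] \<beta>_sym[of y "v - w" 0] \<beta>_sym[of y a' 0]
      by simp
    moreover have "\<beta> a' (v - u) = 0"
      using exp[OF closed(3)] ra p(2)[OF w(1), folded a'_def] closed vuc zero_closed
      by (simp add: \<beta>_diff \<beta>_sym[of a' "v - u" 0])
    ultimately show ?thesis
      unfolding x_eq using yc closed vuc zero_closed
      by (simp add: \<beta>_add \<beta>_smult[of _ 0] smult_closed)
  qed
  then show ?case
    using usp unfolding \<beta>_def by blast
qed

text \<open>
  The complement of a left ideal \<open>I\<close> is its orthogonal complement for the form \<open>(x, s y)\<close>. It is a left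
  ideal because left multiplication by \<open>c\<close> is adjoint to left multiplication by \<open>s c\<close>, under which \<open>I\<close>
  is stable.
\<close>

lemma semisimple_if_anisotropic:
  assumes anti: "linear_involutive_antiautomorphism s"
    and inv: "\<And>x. x \<in> carrier C \<Longrightarrow> functional C (s x) = functional C x"
    and aniso: "\<And>x. \<lbrakk>x \<in> carrier C; pairing C x (s x) = 0\<rbrakk> \<Longrightarrow> x = 0"
  shows semisimple
  unfolding semisimple_def
proof (intro allI impI)
  fix I assume I: "left_ideal I"
  note lin = linear_endo_antiautomorphism[OF anti]
  have scl: "s x \<in> carrier C" if "x \<in> carrier C" for x
    using linear_endo_closed[OF lin that] .
  have ss: "s (s x) = x" if "x \<in> carrier C" for x
    using anti that unfolding linear_involutive_antiautomorphism_def by blast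
  have smul: "s (mult C x y) = mult C (s y) (s x)" if "x \<in> carrier C" "y \<in> carrier C" for x y
    using anti that unfolding linear_involutive_antiautomorphism_def by blast
  have sym: "pairing C x (s y) = pairing C y (s x)" if "x \<in> carrier C" "y \<in> carrier C" for x y
    using inv[of "mult C x (s y)"] that
    unfolding pairing_def by (simp add: smul scl ss mult_closed)
  have Isub: "subspace I" "I \<subseteq> carrier C"
    and Imul: "\<And>c x. c \<in> carrier C \<Longrightarrow> x \<in> I \<Longrightarrow> mult C c x \<in> I"
    using I unfolding left_ideal_def by auto
  define J where "J = {y \<in> carrier C. \<forall>x\<in>I. pairing C y (s x) = 0}"
  have "left_ideal J"
    unfolding left_ideal_def
  proof (intro conjI ballI)
    show "subspace J"
    proof (rule subspaceI)
      have I: "s x \<in> carrier C" if "x \<in> I" for x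
        using that Isub(2) scl by blast
      show "0 \<in> J"
        unfolding J_def using I by (simp add: pairing_zero_left zero_closed)
      show "x + y \<in> J" if "x \<in> J" "y \<in> J" for x y
        using that unfolding J_def by (simp add: I pairing_add_left add_closed)
      show "smult C r x \<in> J" if "x \<in> J" for r x
        using that unfolding J_def by (simp add: I pairing_smult_left smult_closed)
    qed
    show "J \<subseteq> carrier C"
      unfolding J_def by blast
    fix c y assume c: "c \<in> carrier C" and y: "y \<in> J"
    then have yc: "y \<in> carrier C" unfolding J_def by blast
    have "pairing C (mult C c y) (s x) = 0" if x: "x \<in> I" for x
    proof -
      have xc: "x \<in> carrier C" using x Isub by blast
      have "pairing C (mult C c y) (s x) = pairing C c (mult C y (s x))"
        unfolding pairing_def using c yc xc by (simp add: mult_assoc scl)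
      also have "\<dots> = pairing C (mult C y (s x)) c"
        using c yc xc by (intro pairing_sym) (auto simp: mult_closed scl)
      also have "\<dots> = pairing C y (s (mult C (s c) x))"
        unfolding pairing_def using c yc xc by (simp add: mult_assoc scl smul ss)
      also have "\<dots> = 0"
        using y Imul[OF scl[OF c] x] unfolding J_def by blast
      finally show ?thesis .
    qed
    then show "mult C c y \<in> J"
      unfolding J_def using c yc by (simp add: mult_closed)
  qed
  moreover have "I \<inter> J = {0}"
  proof (intro equalityI subsetI)
    fix x assume "x \<in> I \<inter> J"
    then show "x \<in> {0}"
      using aniso[of x] unfolding J_def by simp
  next
    fix x :: 'a assume "x \<in> {0}"
    then show "x \<in> I \<inter> J"
      using subspace_0[OF Isub(1)] subspace_0 \<open>left_ideal J\<close> unfolding left_ideal_def by simp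
  qed
  moreover have "{x + y |x y. x \<in> I \<and> y \<in> J} = carrier C"
  proof (intro equalityI subsetI)
    fix v assume v: "v \<in> carrier C"
    obtain T where T: "finite T" "span T = carrier C"
      using fin_dim by blast
    obtain S where S: "S \<subseteq> I" "independent S" "I \<subseteq> span S"
      using maximal_independent_subset[of I] by blast
    have finS: "finite S"
      using independent_span_bound[OF T(1) S(2)] S(1) Isub(2) T(2) by blast
    have spS: "span S = I"
      using S span_minimal[OF S(1) Isub(1)] by blast
    have "S \<subseteq> carrier C"
      using S(1) Isub(2) by blast
    with finS have "\<exists>u\<in>span S. \<forall>x\<in>span S. pairing C x (s (v - u)) = 0"
      using ex_orthogonal_projection[OF lin sym aniso _ _ v, of S] by blast
    then obtain u where u: "u \<in> I" "\<And>x. x \<in> I \<Longrightarrow> pairing C x (s (v - u)) = 0"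
      unfolding spS by blast
    have "v - u \<in> J"
    proof -
      have uc: "u \<in> carrier C" "v - u \<in> carrier C"
        using u(1) v Isub(2) diff_closed by auto
      moreover have "pairing C (v - u) (s x) = 0" if "x \<in> I" for x
        using u(2)[OF that] sym[of x "v - u"] that Isub(2) uc by auto
      ultimately show ?thesis
        unfolding J_def by blast
    qed
    then show "v \<in> {x + y |x y. x \<in> I \<and> y \<in> J}"
      using u(1) by (intro CollectI exI[of _ u] exI[of _ "v - u"]) simp
  next
    fix v assume "v \<in> {x + y |x y. x \<in> I \<and> y \<in> J}"
    then show "v \<in> carrier C"
      using Isub(2) add_closed unfolding J_def by blast
  qed
  ultimately show "\<exists>J. left_ideal J \<and> I \<inter> J = {0} \<and> {x + y |x y. x \<in> I \<and> y \<in> J} = carrier C"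
    by blast
qed

end

section \<open>The Casimir operator of a division algebra with conjugation\<close>

text \<open>
  The axioms say that \<open>x \<mapsto> 2 * re x - x\<close> is an antiautomorphism and that \<open>E\<close> is an orthonormal
  basis containing 1 for the inner product \<open>re (x * cj y)\<close>. The identities \<open>re (x * y) = re (y * x)\<close>
  and \<open>cj (cj x) = x\<close> and the relations \<open>e * e = - 1\<close> for the imaginary units follow.
\<close>

locale conjugation_division_algebra =
  fixes re :: "'d::real_div_algebra \<Rightarrow> real" and cj :: "'d \<Rightarrow> 'd" and E :: "'d set"
  assumes linear_re: "linear re"
    and re_one: "re 1 = 1"
    and cj_eq: "cj x = (2 * re x) *\<^sub>R 1 - x"
    and cj_mult: "cj (x * y) = cj y * cj x"
    and finite_E: "finite E"
    and one_in_E: "1 \<in> E"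
    and orthonormal: "\<lbrakk>e \<in> E; f \<in> E\<rbrakk> \<Longrightarrow> re (e * cj f) = (if e = f then 1 else 0)"
    and expansion: "(\<Sum>e\<in>E. re (x * cj e) *\<^sub>R e) = x"
    and card_E: "card E \<in> {1, 2, 4}"
begin

abbreviation d :: real where "d \<equiv> real (card E)"

lemma re_simps [simp]:
  "re (x + y) = re x + re y" "re (x - y) = re x - re y" "re (r *\<^sub>R x) = r * re x" "re 0 = 0"
  "re (sum g I) = (\<Sum>i\<in>I. re (g i))" "re 1 = 1" "re (of_real r) = r"
  using linear_re re_one by (auto simp: linear_add linear_diff linear_scale linear_0 linear_sum of_real_def)

lemma linear_cj: "linear cj"
  by (rule linearI) (simp_all add: cj_eq algebra_simps)

lemma cj_simps [simp]:
  "cj (x + y) = cj x + cj y" "cj (x - y) = cj x - cj y" "cj (r *\<^sub>R x) = r *\<^sub>R cj x" "cj 0 = 0"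
  "cj (sum g I) = (\<Sum>i\<in>I. cj (g i))" "cj (of_real r) = of_real r" "cj 1 = 1"
  using linear_cj
  by (auto simp: linear_add linear_diff linear_scale linear_0 linear_sum)
    (simp_all add: cj_eq of_real_def flip: scaleR_left_diff_distrib,
     simp_all add: scaleR_2)

lemma cj_cj [simp]: "cj (cj x) = x" and re_cj [simp]: "re (cj x) = re x"
  by (simp_all add: cj_eq)

lemma re_mult_commute: "re (x * y) = re (y * x)"
proof -
  have "re (x * y) = re (cj y * cj x)"
    by (metis cj_mult re_cj)
  also have "\<dots> = re (y * x)"
    by (simp add: cj_eq algebra_simps)
  finally show ?thesis .
qed

lemma conj_expansion: "(\<Sum>e\<in>E. re (x * e) *\<^sub>R cj e) = x"
proof -
  have "re (cj x * cj e) = re (x * e)" for e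
    by (metis cj_mult re_cj re_mult_commute)
  then have "cj x = (\<Sum>e\<in>E. re (x * e) *\<^sub>R e)"
    using expansion[of "cj x"] by simp
  then have "cj (cj x) = cj (\<Sum>e\<in>E. re (x * e) *\<^sub>R e)"
    by (rule arg_cong)
  then show ?thesis by simp
qed

lemma re_mult_cj_commute: "re (x * cj y) = re (y * cj x)"
  by (metis cj_mult cj_cj re_cj)

text \<open>
  Parseval's identity for \<open>E\<close>; it makes \<open>re (x * cj y)\<close> positive definite.
\<close>

lemma re_mult_cj_self: "re (x * cj x) = (\<Sum>e\<in>E. (re (x * cj e))\<^sup>2)"
proof -
  have "re (x * cj x) = re ((\<Sum>e\<in>E. re (x * cj e) *\<^sub>R e) * cj x)"
    by (simp only: expansion)
  also have "\<dots> = (\<Sum>e\<in>E. re (x * cj e) * re (e * cj x))"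
    by (simp add: sum_distrib_right)
  also have "\<dots> = (\<Sum>e\<in>E. (re (x * cj e))\<^sup>2)"
    by (simp add: power2_eq_square re_mult_cj_commute[of _ x])
  finally show ?thesis .
qed

lemma re_mult_cj_self_nonneg: "0 \<le> re (x * cj x)"
  unfolding re_mult_cj_self by (simp add: sum_nonneg)

lemma re_mult_cj_self_eq_0: "re (x * cj x) = 0 \<longleftrightarrow> x = 0"
proof
  assume "re (x * cj x) = 0"
  then have "\<forall>e\<in>E. re (x * cj e) = 0"
    by (simp add: re_mult_cj_self sum_nonneg_eq_0_iff finite_E)
  then show "x = 0"
    using expansion[of x] by simp
qed simp

lemma d_pos: "0 < d"
  using finite_E one_in_E by (simp add: card_gt_0_iff) blast

lemma cj_imaginary: "e \<in> E \<Longrightarrow> e \<noteq> 1 \<Longrightarrow> cj e = - e"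
  using orthonormal[of e 1] one_in_E by (simp add: cj_eq[of e])

text \<open>
  The element \<open>cj e * e\<close> is fixed by \<open>cj\<close>, hence equal to its real part, which is 1 by orthonormality.
\<close>

lemma cj_mult_self: assumes "e \<in> E" shows "cj e * e = 1"
proof -
  have c: "cj (cj e * e) = cj e * e"
    by (simp add: cj_mult)
  have "re (cj e * e) = 1"
    using orthonormal[OF assms assms] by (simp add: re_mult_commute)
  then have "cj e * e = 2 - cj e * e"
    using cj_eq[of "cj e * e"] unfolding c by (simp add: scaleR_2)
  then have "2 *\<^sub>R (cj e * e) = 2 *\<^sub>R 1"
    by (simp add: scaleR_2 eq_diff_eq)
  then show ?thesis by simp
qed

lemma mult_cj_self: "e \<in> E \<Longrightarrow> e * cj e = 1"
  using cj_mult_self[of e] cj_imaginary[of e] by (cases "e = 1") auto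

lemma square_imaginary: "e \<in> E \<Longrightarrow> e \<noteq> 1 \<Longrightarrow> e * e = - 1"
  using cj_mult_self[of e] cj_imaginary[of e] by (metis minus_minus mult_minus_left)

lemma sum_E_imaginary: "(\<Sum>e\<in>E. g e) = g 1 + (\<Sum>e\<in>E - {1}. g e)"
  using finite_E one_in_E by (simp add: sum.remove)

lemma card_imaginary: "real (card (E - {1})) = d - 1"
  using finite_E one_in_E d_pos by (simp add: card_Diff_singleton of_nat_diff)

lemma sum_squares_E: "(\<Sum>e\<in>E. e * e) = of_real (2 - d)"
proof -
  have "(\<Sum>e\<in>E - {1}. e * e) = (\<Sum>e\<in>E - {1}. - 1)"
    using square_imaginary by (intro sum.cong) auto
  also have "\<dots> = - of_real (real (card (E - {1})))"
    by simp
  finally show ?thesis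
    by (subst sum_E_imaginary) (simp only: card_imaginary, simp)
qed

lemma span_E: "span E = UNIV"
proof -
  have "x \<in> span E" for x
  proof -
    have "(\<Sum>e\<in>E. re (x * cj e) *\<^sub>R e) \<in> span E"
      by (rule span_sum) (simp add: span_scale span_base)
    then show ?thesis by (simp only: expansion)
  qed
  then show ?thesis by blast
qed

lemma independent_E: "independent E"
proof (rule independent_if_scalars_zero[OF finite_E])
  fix g e assume g: "(\<Sum>e\<in>E. g e *\<^sub>R e) = 0" and e: "e \<in> E"
  have "0 = re ((\<Sum>e\<in>E. g e *\<^sub>R e) * cj e)"
    by (simp add: g)
  also have "\<dots> = (\<Sum>f\<in>E. if f = e then g f else 0)"
    by (simp add: sum_distrib_right orthonormal e if_distrib cong: if_cong)
  also have "\<dots> = g e"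
    using e finite_E by simp
  finally show "g e = 0" by simp
qed

lemma dim_UNIV_eq: "dim (UNIV :: 'd set) = card E"
  using dim_eq_card[of E UNIV] span_E independent_E by simp

definition casimir :: "'d \<Rightarrow> 'd" where
  "casimir q = (\<Sum>e\<in>E. e * q * cj e)"

lemma linear_casimir: "linear casimir"
  unfolding casimir_def by (rule linearI) (simp_all add: algebra_simps sum.distrib scaleR_sum_right)

text \<open>
  The coefficients that express left multiplication by \<open>x\<close> in the basis \<open>E\<close> are also those that
  express right multiplication by \<open>x\<close> in the dual basis \<open>cj ` E\<close>, since
  \<open>re (x * e * cj f) = re (cj f * x * e)\<close>.
\<close>

lemma casimir_central: "x * casimir q = casimir q * x"
proof -
  have ex: "x * e * q * cj e = (\<Sum>f\<in>E. re (x * e * cj f) *\<^sub>R (f * q * cj e))" for e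
  proof -
    have "x * e * q * cj e = (\<Sum>f\<in>E. re (x * e * cj f) *\<^sub>R f) * q * cj e"
      by (simp only: expansion)
    then show ?thesis by (simp add: sum_distrib_right)
  qed
  have fx: "f * q * (cj f * x) = (\<Sum>e\<in>E. re (x * e * cj f) *\<^sub>R (f * q * cj e))" for f
  proof -
    have "re (cj f * x * e) = re (x * e * cj f)" for e
      by (metis mult.assoc re_mult_commute)
    then have "cj f * x = (\<Sum>e\<in>E. re (x * e * cj f) *\<^sub>R cj e)"
      using conj_expansion[of "cj f * x"] by simp
    then have "f * q * (cj f * x) = f * q * (\<Sum>e\<in>E. re (x * e * cj f) *\<^sub>R cj e)"
      by (rule arg_cong)
    then show ?thesis by (simp add: sum_distrib_left)
  qed
  have "x * casimir q = (\<Sum>e\<in>E. x * e * q * cj e)"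
    by (simp add: casimir_def sum_distrib_left mult.assoc)
  also have "\<dots> = (\<Sum>e\<in>E. \<Sum>f\<in>E. re (x * e * cj f) *\<^sub>R (f * q * cj e))"
    by (simp only: ex)
  also have "\<dots> = (\<Sum>f\<in>E. \<Sum>e\<in>E. re (x * e * cj f) *\<^sub>R (f * q * cj e))"
    by (rule sum.swap)
  also have "\<dots> = (\<Sum>f\<in>E. f * q * (cj f * x))"
    by (simp only: fx)
  also have "\<dots> = casimir q * x"
    by (simp add: casimir_def sum_distrib_right mult.assoc)
  finally show ?thesis .
qed

lemma casimir_of_central:
  assumes "\<And>x. z * x = x * z"
  shows "casimir z = d *\<^sub>R z"
proof -
  have "e * z * cj e = z" if "e \<in> E" for e
    using assms[of "cj e"] mult_cj_self[OF that] by (metis mult.assoc mult_1_left)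
  then show ?thesis
    by (simp add: casimir_def scaleR_conv_of_real)
qed

text \<open>
  Under \<open>re\<close> the factor \<open>cj e\<close> can be moved cyclically to the front, where it cancels \<open>e\<close>.
\<close>

lemma re_casimir_mult_central:
  assumes "\<And>x. z * x = x * z"
  shows "re (casimir q * z) = d * re (q * z)"
proof -
  have "re (e * q * cj e * z) = re (q * z)" if "e \<in> E" for e
  proof -
    have "re (e * q * cj e * z) = re ((e * q * z) * cj e)"
      by (metis assms mult.assoc)
    also have "\<dots> = re ((cj e * e) * (q * z))"
      by (metis re_mult_commute mult.assoc)
    finally show ?thesis
      by (simp add: cj_mult_self that)
  qed
  then show ?thesis
    by (simp add: casimir_def sum_distrib_right)
qed

lemma cj_casimir: "cj (casimir q) = casimir (cj q)"
  by (simp add: casimir_def cj_mult mult.assoc)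

text \<open>
  Applying \<open>cj x = 2 * re x - x\<close> to \<open>x = e * cj q\<close> turns \<open>e * q * cj e\<close> into
  \<open>2 * re (q * cj e) * e - e * e * cj q\<close>; the first part sums to \<open>2 * q\<close>, the second one involves only
  the sum of the squares.
\<close>

lemma casimir_eq: "casimir q = 2 *\<^sub>R q + (d - 2) *\<^sub>R cj q"
proof -
  have "e * q * cj e = (2 * re (q * cj e)) *\<^sub>R e - e * e * cj q" for e
  proof -
    have "q * cj e = (2 * re (q * cj e)) *\<^sub>R 1 - e * cj q"
      using cj_eq[of "e * cj q"] unfolding cj_mult cj_cj re_mult_cj_commute[of e q] .
    then have "e * (q * cj e) = e * ((2 * re (q * cj e)) *\<^sub>R 1 - e * cj q)"
      by (rule arg_cong)
    then show ?thesis
      by (simp add: right_diff_distrib mult.assoc)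
  qed
  then have "casimir q = (\<Sum>e\<in>E. 2 *\<^sub>R (re (q * cj e) *\<^sub>R e)) - (\<Sum>e\<in>E. e * e) * cj q"
    by (simp add: casimir_def sum_subtractf sum_distrib_right)
  also have "\<dots> = 2 *\<^sub>R q - of_real (2 - d) * cj q"
    by (simp only: scaleR_sum_right[symmetric] expansion sum_squares_E)
  also have "\<dots> = 2 *\<^sub>R q + (d - 2) *\<^sub>R cj q"
    by (simp only: scaleR_conv_of_real[symmetric] scaleR_left_diff_distrib) simp
  finally show ?thesis .
qed

text \<open>
  By the closed form, \<open>casimir 1 = d\<close> and \<open>casimir e = (4 - d) * e\<close> for an imaginary unit \<open>e\<close>. The two
  sides then differ by \<open>- 2 * (d - 1) * (d - 2) * (d - 4)\<close>, so that the identity characterizes the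
  dimensions 1, 2 and 4.
\<close>

lemma sum_casimir_squares: "(\<Sum>e\<in>E. casimir e * casimir e) = of_real (d * (2 - d)\<^sup>2)"
proof -
  have "(\<Sum>e\<in>E - {1}. casimir e * casimir e) = (\<Sum>e\<in>E - {1}. of_real (- (4 - d)\<^sup>2))"
  proof (intro sum.cong refl)
    fix e assume e: "e \<in> E - {1}"
    have "casimir e = (4 - d) *\<^sub>R e"
    proof -
      have "casimir e = (2 - (d - 2)) *\<^sub>R e"
        using e cj_imaginary[of e]
        by (simp only: casimir_eq scaleR_left_diff_distrib[of 2 "d - 2"] scaleR_minus_right) simp
      then show ?thesis by simp
    qed
    then show "casimir e * casimir e = of_real (- (4 - d)\<^sup>2)"
      using e by (simp add: square_imaginary of_real_def power2_eq_square)
  qed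
  also have "\<dots> = of_real (- (d - 1) * (4 - d)\<^sup>2)"
  proof -
    have "(\<Sum>e\<in>E - {1}. of_real (- (4 - d)\<^sup>2) :: 'd)
        = of_real (real (card (E - {1})) * (- (4 - d)\<^sup>2))"
      by (simp only: sum_constant of_real_mult of_real_of_nat_eq)
    then show ?thesis
      by (simp only: card_imaginary mult_minus_left mult_minus_right)
  qed
  finally have imaginary: "(\<Sum>e\<in>E - {1}. casimir e * casimir e)
      = of_real (- (d - 1) * (4 - d)\<^sup>2)" .
  have "casimir 1 * casimir 1 = of_real (d\<^sup>2)"
    by (simp add: casimir_of_central of_real_def power2_eq_square)
  then have "(\<Sum>e\<in>E. casimir e * casimir e) = of_real (d\<^sup>2 + - (d - 1) * (4 - d)\<^sup>2)"
    by (subst sum_E_imaginary) (simp only: imaginary of_real_add)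
  also have "d\<^sup>2 + - (d - 1) * (4 - d)\<^sup>2 = d * (2 - d)\<^sup>2"
    using card_E by (auto simp: power2_eq_square)
  finally show ?thesis .
qed

end

section \<open>Matrices over a real algebra\<close>

definition elementary :: "'n \<Rightarrow> 'n \<Rightarrow> 'd::real_algebra_1 \<Rightarrow> 'd^'n^'n" where
  "elementary i j a = (\<chi> k l. if k = i \<and> l = j then a else 0)"

lemma elementary_nth [simp]: "elementary i j a $ k $ l = (if k = i \<and> l = j then a else 0)"
  by (simp add: elementary_def)

lemma matrix_mult_nth: "(x ** y) $ i $ j = (\<Sum>k\<in>UNIV. x $ i $ k * y $ k $ j)"
  by (simp add: matrix_matrix_mult_def)

lemma mat_nth: "mat a $ i $ j = (if i = j then a else 0)"
  by (simp add: mat_def)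

lemma mat_mult_nth: "(mat a ** x) $ i $ j = a * x $ i $ j"
  and mult_mat_nth: "(x ** mat a) $ i $ j = x $ i $ j * a"
  for x :: "'d::real_algebra_1^'n^'n"
  by (simp_all add: matrix_mult_nth mat_nth if_distrib if_distribR cong: if_cong)

lemma mat_add: "mat (x + y) = mat x + mat y"
  for x y :: "'d::real_algebra_1"
  by (simp add: vec_eq_iff mat_nth)

lemma mat_scaleR: "mat (r *\<^sub>R x) = r *\<^sub>R mat x"
  for x :: "'d::real_algebra_1"
  by (simp add: vec_eq_iff mat_nth)

lemma mat_mult: "mat (x * y) = mat x ** mat y"
  for x y :: "'d::real_algebra_1"
  by (simp add: vec_eq_iff mat_mult_nth) (simp add: mat_nth)

lemma matrix_add_mult: "(x + y) ** z = x ** z + y ** z"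
  for x y z :: "'d::real_algebra_1^'n^'n"
  by (simp add: vec_eq_iff matrix_mult_nth distrib_right sum.distrib)

lemma matrix_mult_elementary_nth:
  "(x ** elementary i j a) $ k $ l = (if l = j then x $ k $ i * a else 0)"
  for x :: "'d::real_algebra_1^'n^'n"
  by (simp add: matrix_mult_nth if_distrib cong: if_cong)

lemma elementary_mult_elementary:
  "elementary i j a ** elementary k l b = (if j = k then elementary i l (a * b) else 0)"
  by (simp add: vec_eq_iff matrix_mult_elementary_nth)

lemma sandwich_elementary_nth:
  "(x ** elementary i j a ** y) $ k $ l = x $ k $ i * a * y $ j $ l"
  for x y :: "'d::real_algebra_1^'n^'n"
  by (subst matrix_mult_nth) (simp add: matrix_mult_elementary_nth if_distrib if_distribR cong: if_cong)

lemma trace_mult_elementary: "trace (x ** elementary j i a) = x $ i $ j * a"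
  for x :: "'d::real_algebra_1^'n^'n"
  by (simp add: trace_def matrix_mult_elementary_nth)

lemma conj_transpose_nth: "conj_transpose cj x $ i $ j = cj (x $ j $ i)"
  by (simp add: conj_transpose_def transpose_def)

context conjugation_division_algebra
begin

lemma re_trace_mult_commute: "re (trace (x ** y)) = re (trace (y ** x))" for x y :: "'d^'n^'n"
proof -
  have "re (trace (x ** y)) = (\<Sum>i\<in>UNIV. \<Sum>k\<in>UNIV. re (y $ k $ i * x $ i $ k))"
    by (simp add: trace_def matrix_mult_nth re_mult_commute[of "x $ _ $ _"])
  also have "\<dots> = (\<Sum>k\<in>UNIV. \<Sum>i\<in>UNIV. re (y $ k $ i * x $ i $ k))"
    by (rule sum.swap)
  also have "\<dots> = re (trace (y ** x))"
    by (simp add: trace_def matrix_mult_nth)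
  finally show ?thesis .
qed

lemma re_trace_conj_transpose_eq_0:
  fixes x :: "'d^'n^'n"
  assumes "re (trace (x ** conj_transpose cj x)) = 0"
  shows "x = 0"
proof -
  have "(\<Sum>i\<in>UNIV. \<Sum>k\<in>UNIV. re (x $ i $ k * cj (x $ i $ k))) = 0"
    using assms by (simp add: trace_def matrix_mult_nth conj_transpose_nth)
  then have "re (x $ i $ k * cj (x $ i $ k)) = 0" for i k
    by (simp add: sum_nonneg_eq_0_iff sum_nonneg re_mult_cj_self_nonneg)
  then show ?thesis
    by (simp add: re_mult_cj_self_eq_0 vec_eq_iff)
qed

lemma matrix_expansion:
  "(\<Sum>(i, j, e)\<in>UNIV \<times> UNIV \<times> E. re (x $ i $ j * cj e) *\<^sub>R elementary i j e) = x"
  for x :: "'d^'n^'n"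
proof -
  have "(\<Sum>e\<in>E. re (x $ i $ j * cj e) *\<^sub>R elementary i j e $ k $ l)
      = (if l = j then if k = i then x $ k $ l else 0 else 0)" for i j k l
    by (simp add: expansion)
  then have "(\<Sum>i\<in>UNIV. \<Sum>j\<in>UNIV. \<Sum>e\<in>E. re (x $ i $ j * cj e) *\<^sub>R elementary i j e) = x"
    by (simp add: vec_eq_iff sum_component del: elementary_nth)
  then show ?thesis
    by (simp add: sum.cartesian_product)
qed

section \<open>The Frobenius pairs\<close>

lemma A_H_eq:
  "A_H re \<mu> = \<lparr>carrier = {z. \<forall>x. z * x = x * z}, smult = (*\<^sub>R), mult = (*), unity = 1,
     functional = (\<lambda>a. \<mu>\<^sup>2 * re a / d)\<rparr>"
  by (simp add: A_H_def dim_UNIV_eq)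

lemma smult_A: "smult (A_H re \<mu>) = (*\<^sub>R)"
  and mult_A: "mult (A_H re \<mu>) = (*)"
  by (simp_all add: A_H_eq)

lemma central_iff: "z \<in> carrier (A_H re \<mu>) \<longleftrightarrow> (\<forall>x. z * x = x * z)"
  by (simp add: A_H_eq)

lemma pairing_A: "pairing (A_H re \<mu>) x y = \<mu>\<^sup>2 * re (x * y) / d"
  by (simp add: pairing_def A_H_eq)

lemma pairing_B: "pairing (B_H re \<mu>) x y = \<mu> * re (trace (x ** y))"
  by (simp add: pairing_def B_H_def)

lemma casimir_in_A: "casimir q \<in> carrier (A_H re \<mu>)"
  by (simp add: central_iff casimir_central)

lemma cj_in_A: "z \<in> carrier (A_H re \<mu>) \<Longrightarrow> cj z \<in> carrier (A_H re \<mu>)"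
  unfolding central_iff by (metis cj_mult cj_cj)

lemma span_casimir_E: "span (casimir ` E) = carrier (A_H re \<mu>)"
proof -
  have "span (casimir ` E) = range casimir"
    by (simp add: linear_span_image[OF linear_casimir] span_E)
  also have "\<dots> = carrier (A_H re \<mu>)"
  proof (intro equalityI subsetI)
    fix z assume "z \<in> carrier (A_H re \<mu>)"
    then have "casimir ((1 / d) *\<^sub>R z) = z"
      using casimir_of_central[of z] d_pos
      by (simp add: linear_scale[OF linear_casimir] central_iff)
    then show "z \<in> range casimir"
      by (metis rangeI)
  qed (use casimir_in_A in blast)
  finally show ?thesis .
qed

text \<open>
  The centre is spanned by the finite set \<open>casimir ` E\<close>, because the Casimir operator maps onto it.
\<close>

lemma fd_algebra_A: "fd_algebra (A_H re \<mu>)"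
proof (intro fd_algebra.intro fd_algebra_axioms.intro)
  show "vector_space (smult (A_H re \<mu>))"
    using real_vector.vector_space_axioms by (simp add: A_H_eq)
  have "module.span (smult (A_H re \<mu>)) = span"
    unfolding span_raw_def A_H_eq by simp
  then have "module.span (smult (A_H re \<mu>)) (casimir ` E) = carrier (A_H re \<mu>)"
    by (simp only: span_casimir_E)
  then show "\<exists>S. finite S \<and> module.span (smult (A_H re \<mu>)) S = carrier (A_H re \<mu>)"
    using finite_E by blast
next
  fix x y assume "x \<in> carrier (A_H re \<mu>)" "y \<in> carrier (A_H re \<mu>)"
  then have "x * y * w = w * (x * y)" for w
    unfolding central_iff by (metis mult.assoc)
  then have "x * y \<in> carrier (A_H re \<mu>)"
    unfolding central_iff by blast
  then show "mult (A_H re \<mu>) x y \<in> carrier (A_H re \<mu>)"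
    by (simp only: A_H_eq algebra_data.simps)
qed (simp_all (no_asm) add: A_H_eq mult.assoc distrib_left distrib_right)

lemma fd_algebra_B: "fd_algebra (B_H re \<mu> :: (real, 'd^'n^'n) frobenius_data)"
proof (intro fd_algebra.intro fd_algebra_axioms.intro)
  let ?B = "B_H re \<mu> :: (real, 'd^'n^'n) frobenius_data"
  show "vector_space (smult ?B)"
    using real_vector.vector_space_axioms by (simp add: B_H_def)
  define S :: "('d^'n^'n) set" where "S = (\<lambda>(i, j, e). elementary i j e) ` (UNIV \<times> UNIV \<times> E)"
  have elementary_in_S: "elementary i j e \<in> S" if "e \<in> E" for i j e
    unfolding S_def using that by force
  have "x \<in> span S" for x
  proof -
    have "(\<Sum>(i, j, e)\<in>UNIV \<times> UNIV \<times> E. re (x $ i $ j * cj e) *\<^sub>R elementary i j e) \<in> span S"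
      using elementary_in_S by (intro span_sum) (auto simp: span_scale span_base)
    then show ?thesis by (simp only: matrix_expansion)
  qed
  moreover have "finite S"
    using finite_E by (simp add: S_def)
  ultimately show "\<exists>S. finite S \<and> module.span (smult ?B) S = carrier ?B"
    by (intro exI[of _ S]) (auto simp: B_H_def span_raw_def)
qed (simp_all add: B_H_def matrix_mul_assoc matrix_add_ldistrib matrix_add_mult
    scalar_matrix_assoc matrix_scalar_ac)

lemma frobenius_pair_A: assumes "\<mu> \<noteq> 0" shows "frobenius_pair (A_H re \<mu>)"
proof (intro frobenius_pair.intro frobenius_pair_axioms.intro fd_algebra_A)
  fix x assume x: "x \<in> carrier (A_H re \<mu>)"
    and "\<And>y. y \<in> carrier (A_H re \<mu>) \<Longrightarrow> pairing (A_H re \<mu>) x y = 0"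
  then have "pairing (A_H re \<mu>) x (cj x) = 0"
    using cj_in_A by blast
  then show "x = 0"
    using assms d_pos by (simp add: pairing_A re_mult_cj_self_eq_0)
qed (simp_all add: pairing_A re_mult_commute, simp_all add: A_H_eq field_simps add_divide_distrib)

lemma frobenius_pair_B:
  assumes "\<mu> \<noteq> 0"
  shows "frobenius_pair (B_H re \<mu> :: (real, 'd^'n^'n) frobenius_data)"
proof (intro frobenius_pair.intro frobenius_pair_axioms.intro fd_algebra_B)
  let ?B = "B_H re \<mu> :: (real, 'd^'n^'n) frobenius_data"
  fix x :: "'d^'n^'n"
  assume "\<And>y. y \<in> carrier ?B \<Longrightarrow> pairing ?B x y = 0"
  then have "pairing ?B x (conj_transpose cj x) = 0"
    by (simp add: B_H_def)
  then show "x = 0"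
    using assms re_trace_conj_transpose_eq_0 by (simp add: pairing_B)
next
  let ?B = "B_H re \<mu> :: (real, 'd^'n^'n) frobenius_data"
  fix x y :: "'d^'n^'n"
  show "pairing ?B x y = pairing ?B y x"
    by (simp add: pairing_B re_trace_mult_commute)
qed (simp_all add: B_H_def trace_def sum.distrib algebra_simps sum_distrib_left)

text \<open>
  Applying the projection \<open>casimir / d\<close> to the expansion of a central \<open>x\<close> in the basis \<open>E\<close> gives an
  expansion inside the centre. The factor \<open>1 / \<mu>\<^sup>2\<close> compensates the normalization of the functional.
\<close>

lemma dual_families_A:
  assumes "\<mu> \<noteq> 0"
  shows "frobenius_pair.dual_families (A_H re \<mu>) E
    (\<lambda>e. (1 / d) *\<^sub>R casimir e) (\<lambda>e. (1 / \<mu>\<^sup>2) *\<^sub>R casimir (cj e))"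
proof -
  interpret frobenius_pair "A_H re \<mu>"
    using assms by (rule frobenius_pair_A)
  have closed: "r *\<^sub>R casimir q \<in> carrier (A_H re \<mu>)" for r q
    using smult_closed[OF casimir_in_A] by (simp add: A_H_eq)
  have "(\<Sum>e\<in>E. pairing (A_H re \<mu>) x ((1 / \<mu>\<^sup>2) *\<^sub>R casimir (cj e)) *\<^sub>R (1 / d) *\<^sub>R casimir e) = x"
    if x: "x \<in> carrier (A_H re \<mu>)" for x
  proof -
    have "re (x * casimir (cj e)) = d * re (x * cj e)" for e
      using x re_casimir_mult_central[of x "cj e"]
      by (simp add: central_iff re_mult_commute[of x])
    then have "(\<Sum>e\<in>E. pairing (A_H re \<mu>) x ((1 / \<mu>\<^sup>2) *\<^sub>R casimir (cj e)) *\<^sub>R (1 / d) *\<^sub>R casimir e)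
        = (1 / d) *\<^sub>R (\<Sum>e\<in>E. re (x * cj e) *\<^sub>R casimir e)"
      using assms d_pos by (simp add: pairing_A scaleR_sum_right mult.commute)
    also have "\<dots> = (1 / d) *\<^sub>R casimir (\<Sum>e\<in>E. re (x * cj e) *\<^sub>R e)"
      by (simp add: linear_sum[OF linear_casimir] linear_scale[OF linear_casimir])
    also have "\<dots> = x"
      unfolding expansion using x d_pos casimir_of_central[of x] by (simp add: central_iff)
    finally show ?thesis .
  qed
  then show ?thesis
    unfolding dual_families_def smult_A using finite_E closed by blast
qed

lemma dual_families_B:
  assumes "\<mu> \<noteq> 0"
  shows "frobenius_pair.dual_families (B_H re \<mu> :: (real, 'd^'n^'n) frobenius_data)
    (UNIV \<times> UNIV \<times> E) (\<lambda>(i, j, e). elementary i j e)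
    (\<lambda>(i, j, e). elementary j i ((1 / \<mu>) *\<^sub>R cj e))"
proof -
  let ?B = "B_H re \<mu> :: (real, 'd^'n^'n) frobenius_data"
  interpret frobenius_pair ?B
    using assms by (rule frobenius_pair_B)
  have "(\<Sum>(i, j, e)\<in>UNIV \<times> UNIV \<times> E.
      pairing ?B x (elementary j i ((1 / \<mu>) *\<^sub>R cj e)) *\<^sub>R elementary i j e) = x" for x
    using matrix_expansion[of x] assms by (simp add: pairing_B trace_mult_elementary)
  then show ?thesis
    unfolding dual_families_def using finite_E by (auto simp: B_H_def case_prod_unfold)
qed

section \<open>The Cardy condition\<close>

text \<open>
  By the projection property of the Casimir operator, \<open>casimir (trace b)\<close> represents the functional
  \<open>a \<mapsto> re (trace b * a)\<close> on the centre; non-degeneracy of the pairing makes this representation unique.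
\<close>

lemma dual_map_eq:
  fixes b :: "'d^'n^'n"
  assumes "\<mu> \<noteq> 0"
  shows "dual_map (A_H re \<mu>) (B_H re \<mu>) mat b = (1 / \<mu>) *\<^sub>R casimir (trace b)"
proof -
  interpret frobenius_pair "A_H re \<mu>"
    using assms by (rule frobenius_pair_A)
  let ?t = "(1 / \<mu>) *\<^sub>R casimir (trace b)"
  have tc: "?t \<in> carrier (A_H re \<mu>)"
    using smult_closed[OF casimir_in_A] by (simp add: A_H_eq)
  have pt: "pairing (A_H re \<mu>) ?t a = pairing (B_H re \<mu>) b (mat a)"
    if a: "a \<in> carrier (A_H re \<mu>)" for a
  proof -
    have "trace (b ** mat a) = trace b * a"
      by (simp add: trace_def mult_mat_nth sum_distrib_right)
    then show ?thesis
      using a assms d_pos re_casimir_mult_central[of a "trace b"]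
      by (simp add: pairing_A pairing_B central_iff power2_eq_square)
  qed
  show ?thesis
    unfolding dual_map_def
  proof (rule the_equality)
    show "?t \<in> carrier (A_H re \<mu>) \<and>
        (\<forall>a\<in>carrier (A_H re \<mu>). pairing (A_H re \<mu>) ?t a = pairing (B_H re \<mu>) b (mat a))"
      using tc pt by blast
  next
    fix x assume x: "x \<in> carrier (A_H re \<mu>) \<and>
        (\<forall>a\<in>carrier (A_H re \<mu>). pairing (A_H re \<mu>) x a = pairing (B_H re \<mu>) b (mat a))"
    have "pairing (A_H re \<mu>) (x - ?t) y = 0" if y: "y \<in> carrier (A_H re \<mu>)" for y
      using pairing_add_left[of "x - ?t" ?t y] x pt[OF y] y tc diff_closed[of x ?t] by simp
    then show "x = ?t"
      using pairing_nondegenerate[of "x - ?t"] x tc diff_closed by simp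
  qed
qed

text \<open>
  Evaluated on the family of elementary matrices, the trace is the sum of
  \<open>re (b' $ i $ i * e * b'' $ j $ j * cj e)\<close> over \<open>i\<close>, \<open>j\<close> and \<open>e\<close>, where summation over \<open>e\<close> produces
  the Casimir operator. On the other side, one of the two Casimir operators is absorbed by the
  projection property.
\<close>

lemma cardy_condition:
  fixes b' b'' :: "'d^'n^'n"
  assumes "\<mu> \<noteq> 0"
  shows "pairing (A_H re \<mu>) (dual_map (A_H re \<mu>) (B_H re \<mu>) mat b')
      (dual_map (A_H re \<mu>) (B_H re \<mu>) mat b'')
    = fd_algebra.operator_trace (B_H re \<mu>) (\<lambda>b. mult (B_H re \<mu>) (mult (B_H re \<mu>) b' b) b'')"
proof -
  let ?B = "B_H re \<mu> :: (real, 'd^'n^'n) frobenius_data"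
  interpret B: frobenius_pair ?B
    using assms by (rule frobenius_pair_B)
  have "B.linear_endo (\<lambda>b. mult ?B (mult ?B b' b) b'')"
    by (intro B.linear_endo_comp[OF B.linear_endo_mult_right B.linear_endo_mult_left])
      (simp_all add: B_H_def)
  from B.operator_trace_dual_families[OF dual_families_B[OF assms] this]
  have "B.operator_trace (\<lambda>b. mult ?B (mult ?B b' b) b'')
      = (\<Sum>(i, j, e)\<in>UNIV \<times> UNIV \<times> E. re (b' $ i $ i * e * b'' $ j $ j * cj e))"
    using assms
    by (simp add: case_prod_unfold pairing_B trace_mult_elementary)
      (simp add: B_H_def sandwich_elementary_nth)
  also have "\<dots> = (\<Sum>i\<in>UNIV. \<Sum>j\<in>UNIV. \<Sum>e\<in>E. re (b' $ i $ i * e * b'' $ j $ j * cj e))"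
    by (simp add: sum.cartesian_product)
  also have "\<dots> = (\<Sum>i\<in>UNIV. \<Sum>j\<in>UNIV. re (b' $ i $ i * casimir (b'' $ j $ j)))"
    by (simp add: casimir_def sum_distrib_left mult.assoc)
  also have "\<dots> = re (trace b' * casimir (trace b''))"
    by (simp add: trace_def linear_sum[OF linear_casimir] sum_product)
  finally have *: "B.operator_trace (\<lambda>b. mult ?B (mult ?B b' b) b'')
      = re (trace b' * casimir (trace b''))" .
  have "re (casimir (trace b') * casimir (trace b'')) = d * re (trace b' * casimir (trace b''))"
    by (rule re_casimir_mult_central) (simp add: casimir_central)
  then show ?thesis
    unfolding * dual_map_eq[OF assms] using assms d_pos
    by (simp add: pairing_A power2_eq_square)
qed

section \<open>Involutions and the elements \<open>K\<^sup>\<star>\<close>\<close>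

lemma star_A: "fd_algebra.linear_involutive_antiautomorphism (A_H re \<mu>) cj"
  unfolding fd_algebra.linear_involutive_antiautomorphism_def[OF fd_algebra_A]
  unfolding smult_A mult_A by (simp add: cj_in_A cj_mult)

lemma star_B:
  "fd_algebra.linear_involutive_antiautomorphism
     (B_H re \<mu> :: (real, 'd^'n^'n) frobenius_data) (conj_transpose cj)"
  unfolding fd_algebra.linear_involutive_antiautomorphism_def[OF fd_algebra_B]
  by (auto simp: B_H_def vec_eq_iff conj_transpose_nth matrix_mult_nth cj_mult)

text \<open>
  Since \<open>cj\<close> commutes with the Casimir operator, it turns \<open>casimir (cj e)\<close> into \<open>casimir e\<close>, and the sum
  of the squares of the latter is known.
\<close>

lemma K_star_A:
  assumes "\<mu> \<noteq> 0"
  shows "frobenius_pair.K_star (A_H re \<mu>) cj = of_real ((2 - d)\<^sup>2 / \<mu>\<^sup>2)"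
proof -
  interpret frobenius_pair "A_H re \<mu>"
    using assms by (rule frobenius_pair_A)
  have "K_star cj = (\<Sum>e\<in>E. mult (A_H re \<mu>) ((1 / d) *\<^sub>R casimir e)
      (cj ((1 / \<mu>\<^sup>2) *\<^sub>R casimir (cj e))))"
    using dual_families_A[OF assms] linear_endo_antiautomorphism[OF star_A]
    by (rule K_star_dual_families)
  also have "\<dots> = (1 / (d * \<mu>\<^sup>2)) *\<^sub>R (\<Sum>e\<in>E. casimir e * casimir e)"
    by (simp add: mult_A cj_casimir scaleR_sum_right mult.commute[of d])
  also have "\<dots> = of_real ((2 - d)\<^sup>2 / \<mu>\<^sup>2)"
    unfolding sum_casimir_squares using d_pos
    by (simp only: of_real_mult[symmetric] scaleR_conv_of_real) (simp add: field_simps)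
  finally show ?thesis .
qed

text \<open>
  The involution maps the dual family to the original one up to the factor \<open>1 / \<mu>\<close>, so only the
  squares of the diagonal elementary matrices survive.
\<close>

lemma K_star_B:
  assumes "\<mu> \<noteq> 0"
  shows "frobenius_pair.K_star (B_H re \<mu> :: (real, 'd^'n^'n) frobenius_data) (conj_transpose cj)
    = mat (of_real ((2 - d) / \<mu>))"
proof -
  let ?B = "B_H re \<mu> :: (real, 'd^'n^'n) frobenius_data"
  interpret frobenius_pair ?B
    using assms by (rule frobenius_pair_B)
  have star: "conj_transpose cj (elementary j i ((1 / \<mu>) *\<^sub>R cj e)) = elementary i j ((1 / \<mu>) *\<^sub>R e)"
    for i j :: 'n and e
    by (simp add: vec_eq_iff conj_transpose_nth)
  have "K_star (conj_transpose cj) = (\<Sum>(i, j, e)\<in>UNIV \<times> UNIV \<times> E.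
      elementary i j e ** elementary i j ((1 / \<mu>) *\<^sub>R e))"
    using K_star_dual_families[OF dual_families_B[OF assms] linear_endo_antiautomorphism[OF star_B]]
    by (simp add: case_prod_unfold star) (simp add: B_H_def)
  also have "\<dots> = (\<Sum>i\<in>UNIV. \<Sum>j\<in>UNIV. \<Sum>e\<in>E. elementary i j e ** elementary i j ((1 / \<mu>) *\<^sub>R e))"
    by (simp add: sum.cartesian_product)
  also have "\<dots> = mat (of_real ((2 - d) / \<mu>))"
  proof -
    have "(\<Sum>e\<in>E. elementary i j e ** elementary i j ((1 / \<mu>) *\<^sub>R e) :: 'd^'n^'n)
      = (if j = i then elementary i i (of_real ((2 - d) / \<mu>)) else 0)" for i j
    proof -
      have "(\<Sum>e\<in>E. elementary i i (e * (1 / \<mu>) *\<^sub>R e))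
        = elementary i i ((1 / \<mu>) *\<^sub>R (\<Sum>e\<in>E. e * e))"
        by (auto simp: vec_eq_iff sum_component scaleR_sum_right intro!: sum.neutral)
      also have "(1 / \<mu>) *\<^sub>R (\<Sum>e\<in>E. e * e) = of_real ((2 - d) / \<mu>)"
        unfolding sum_squares_E by (simp add: of_real_def)
      finally show ?thesis
        by (simp add: elementary_mult_elementary)
    qed
    then have "(\<Sum>i\<in>UNIV. \<Sum>j\<in>UNIV. \<Sum>e\<in>E.
        elementary i j e ** elementary i j ((1 / \<mu>) *\<^sub>R e) :: 'd^'n^'n)
      = (\<Sum>i\<in>UNIV. elementary i i (of_real ((2 - d) / \<mu>)))"
      by simp
    also have "(\<Sum>i\<in>UNIV. elementary i i a) = (mat a :: 'd^'n^'n)" for a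
    proof -
      have "(\<Sum>i\<in>UNIV. elementary i i a $ k $ l) = (\<Sum>i\<in>UNIV. if i = k then mat a $ k $ l else 0)"
        for k l :: 'n
        by (intro sum.cong) (auto simp: mat_nth)
      then show ?thesis
        by (simp add: vec_eq_iff sum_component del: elementary_nth)
    qed
    finally show ?thesis .
  qed
  finally show ?thesis .
qed

section \<open>The equipped Cardy--Frobenius algebra\<close>

theorem semisimple_H_alg:
  assumes "\<mu> \<noteq> 0"
  shows "semisimple_real_equipped_cardy_frobenius_algebra
    (H_alg re cj \<mu> :: (real, 'd, 'd^'n^'n) equipped_data)"
proof -
  let ?A = "A_H re \<mu>" and ?B = "B_H re \<mu> :: (real, 'd^'n^'n) frobenius_data"
  interpret A: frobenius_pair ?A
    using assms by (rule frobenius_pair_A)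
  interpret B: frobenius_pair ?B
    using assms by (rule frobenius_pair_B)
  have func_A: "functional ?A (cj x) = functional ?A x" for x
    by (simp add: A_H_eq)
  have func_B: "functional ?B (conj_transpose cj y) = functional ?B y" for y
    by (simp add: B_H_def trace_def conj_transpose_nth)
  have "A.semisimple"
    using star_A func_A
  proof (rule A.semisimple_if_anisotropic)
    show "x = 0" if "pairing ?A x (cj x) = 0" for x
      using that assms d_pos by (simp add: pairing_A re_mult_cj_self_eq_0)
  qed
  moreover have "B.semisimple"
    using star_B func_B
  proof (rule B.semisimple_if_anisotropic)
    show "x = 0" if "pairing ?B x (conj_transpose cj x) = 0" for x
      using that assms re_trace_conj_transpose_eq_0 by (simp add: pairing_B)
  qed
  moreover have "equipped_cardy_frobenius_algebra ?A ?B mat (U_H \<mu>) cj (conj_transpose cj)"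
  proof (intro equipped_cardy_frobenius_algebra.intro equipped_cardy_frobenius_algebra_axioms.intro
      cardy_frobenius_algebra.intro cardy_frobenius_algebra_axioms.intro
      A.frobenius_pair_axioms B.frobenius_pair_axioms star_A star_B func_A func_B)
    show "mat ` carrier ?A \<subseteq> B.center"
    proof
      fix m :: "'d^'n^'n" assume "m \<in> mat ` carrier ?A"
      then obtain z where z: "m = mat z" "z \<in> carrier ?A"
        by blast
      have "mat z ** x = x ** mat z" for x :: "'d^'n^'n"
      proof -
        have "z * x $ i $ j = x $ i $ j * z" for i j
          using z(2) unfolding central_iff by (rule spec)
        then show ?thesis
          unfolding vec_eq_iff mat_mult_nth mult_mat_nth by (intro allI)
      qed
      then show "m \<in> B.center"
        unfolding B.center_def z(1) by (simp add: B_H_def)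
    qed
    show "pairing ?A (dual_map ?A ?B mat b') (dual_map ?A ?B mat b'')
        = B.operator_trace (\<lambda>b. mult ?B (mult ?B b' b) b'')" for b' b''
      by (rule cardy_condition[OF assms])
    show "U_H \<mu> \<in> carrier ?A"
      by (simp add: central_iff U_H_def of_real_def)
    show "mult ?A (U_H \<mu>) (U_H \<mu>) = A.K_star cj"
      unfolding K_star_A[OF assms] U_H_def dim_UNIV_eq
      by (simp only: A_H_eq algebra_data.simps of_real_mult[symmetric])
        (simp add: power2_eq_square)
    show "mat (U_H \<mu>) = B.K_star (conj_transpose cj)"
      unfolding K_star_B[OF assms] U_H_def dim_UNIV_eq ..
    show "mult ?A x y = mult ?A y x" if "x \<in> carrier ?A" for x y
      using that by (simp only: central_iff mult_A)
    show "mat (x + y) = mat x + (mat y :: 'd^'n^'n)" for x y :: 'd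
      by (rule mat_add)
    show "mat (smult ?A r x) = smult ?B r (mat x)" for r x
      by (simp add: smult_A B_H_def mat_scaleR)
    show "mat (mult ?A x y) = mult ?B (mat x) (mat y)" for x y
      by (simp add: mult_A B_H_def mat_mult)
    show "mat (unity ?A) = unity ?B"
      by (simp add: A_H_eq B_H_def)
    show "mat (cj x) = conj_transpose cj (mat x :: 'd^'n^'n)" for x
      by (simp add: vec_eq_iff conj_transpose_nth mat_nth)
  qed
  ultimately show ?thesis
    by (simp add: semisimple_equipped_cardy_frobenius_algebra_def H_alg_def)
qed

end

section \<open>The real numbers, the complex numbers and the quaternions\<close>

lemma conjugation_division_algebra_real:
  "conjugation_division_algebra (\<lambda>r. r) (\<lambda>r. r) {1 :: real}"
  by unfold_locales auto

lemma conjugation_division_algebra_complex: "conjugation_division_algebra Re cnj {1, \<i>}"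
  by unfold_locales (auto simp: complex_eq_iff)

lemma conjugation_division_algebra_quat:
  "conjugation_division_algebra qRe qcnj {1, Quat 0 1 0 0, Quat 0 0 1 0, Quat 0 0 0 1}"
  by unfold_locales (auto simp: quat_eq_iff quat_defs qcnj_def algebra_simps)

theorem proposition3:
  fixes \<mu> :: real
  assumes "\<mu> \<noteq> 0"
  shows
    "semisimple_real_equipped_cardy_frobenius_algebra
       (H_alg (\<lambda>r. r) (\<lambda>r. r) \<mu> :: (real, real, real^'n^'n) equipped_data) \<and>
     semisimple_real_equipped_cardy_frobenius_algebra
       (H_alg Re cnj \<mu> :: (real, complex, complex^'n^'n) equipped_data) \<and>
     semisimple_real_equipped_cardy_frobenius_algebra
       (H_alg qRe qcnj \<mu> :: (real, quat, quat^'n^'n) equipped_data)"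
  using conjugation_division_algebra.semisimple_H_alg[OF conjugation_division_algebra_real assms]
    conjugation_division_algebra.semisimple_H_alg[OF conjugation_division_algebra_complex assms]
    conjugation_division_algebra.semisimple_H_alg[OF conjugation_division_algebra_quat assms]
  by blast

end
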